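(* Let $I\subset\mathbb{Z}^2$ be the finite nonempty set of discovered maze nodes at a fixed time step $t_k$, with wall structure, interface weights $a_{i,j}(l)\in\{0,1,2\}$ and source values $s(x_{i,j},t_k)\ge 0$ as defined in the context, and let $\alpha>0$. Consider the iterations $$u^{r+1}_{i,j}=\frac{\sum_{l\in L_{i,j}}a_{i,j}(l)\,u^r_l+s(x_{i,j},t_k)}{\sum_{l\in L_{i,j}}a_{i,j}(l)+\alpha},\qquad (i,j)\in I,\quad r=0,1,2,\dots,$$ where $L_{i,j}=\{(i+1,j),(i-1,j),(i,j+1),(i,j-1)\}$ and all components are updated simultaneously (Jacobi iteration). Then: (1) For arbitrary initial values $u^0\in\mathbb{R}^{I}$ the iterates $u^r$ converge, as $r\to\infty$, to a unique solution $\tilde u\in\mathbb{R}^{I}$ (independent of $u^0$), namely the unique solution of the linear system $$\Big(\sum_{l\in L_{i,j}}a_{i,j}(l)+\alpha\Big)\tilde u_{i,j}-\sum_{l\in L_{i,j}}a_{i,j}(l)\,\tilde u_l=s(x_{i,j},t_k)\qquad\text{for all }(i,j)\in I.$$ (2) The local maxima of $\tilde u$ are located at unvisited nodes; that is, if $\tilde u$ attains a local maximum at $(i,j)\in I$, then the node $x_{i,j}$ is unvisited.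
   Context: Maze. Maze nodes $x_{i,j}$ are placed at integer points $(i,j)\in\mathbb{Z}^2$. Any two orthogonally adjacent nodes may be separated by a wall. $I=I(t_k)$ is the finite set of indices of nodes discovered up to time step $t_k$. For $(i,j)\in I$ and $l\in L_{i,j}=\{(i+1,j),(i-1,j),(i,j+1),(i,j-1)\}$, call $l$ an accessible neighbor of $(i,j)$ if $l\in I$ and there is no wall between $(i,j)$ and $l$. Every node is assumed to have at least one accessible neighbor. A function $u$ on $I$ attains a local maximum at $(i,j)$ if $u_{i,j}\ge u_l$ for every accessible neighbor $l$ of $(i,j)$. Interface weights. The numbers $a_{i,j}(l)$ come from the standard five-point finite difference approximation (unit grid spacing) of $\Delta u=\alpha u-s$ with second-order homogeneous Neumann conditions at walls and at the boundary of the discovered domain. Explicitly, separately for the horizontal pair $\{(i-1,j),(i+1,j)\}$ and the vertical pair $\{(i,j-1),(i,j+1)\}$: if both members of the pair are accessible neighbors of $(i,j)$, then $a_{i,j}=1$ on each of them; if exactly one member is accessible, then $a_{i,j}=2$ on that member and $a_{i,j}=0$ on the other; if neither is accessible, then $a_{i,j}=0$ on both. Thus $2\le\sum_{l\in L_{i,j}}a_{i,j}(l)\le 4$. Terms with $a_{i,j}(l)=0$ are omitted from sums (so $u_l$ need not be defined for $l\notin I$). Source. The coverage $c(x_{i,j},t_k)\in\{0,1,2,\dots\}$ is the cumulative number of visits of agents to the node $x_{i,j}$ up to time step $t_k$; the node is called visited if $c(x_{i,j},t_k)\ge1$ and unvisited if $c(x_{i,j},t_k)=0$. The source is $s(x_{i,j},t_k)=\max(0,1-c(x_{i,j},t_k))\cdot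 S(t_k)$ with a scaling factor $S(t_k)>0$. Thus $s=S(t_k)$ at unvisited nodes and $s=0$ at visited nodes.
   Formalization: Part (2) is proved only for local maxima at nodes joined to some unvisited node by a (possibly empty) path of accessible neighbors; without this it fails, since the solution vanishes on any connected component whose nodes are all visited. *)

theory Defs
  imports "HOL-Analysis.Analysis"
begin

type_synonym node = "int \<times> int"

definition neighbors :: "node \<Rightarrow> node set" where
  "neighbors p = (case p of (i, j) \<Rightarrow> {(i + 1, j), (i - 1, j), (i, j + 1), (i, j - 1)})"

text \<open>A wall is recorded as the unordered pair of the two nodes that it separates.\<close>

definition accessible :: "node set \<Rightarrow> node set set \<Rightarrow> node \<Rightarrow> node \<Rightarrow> bool" where
  "accessible I W p l \<longleftrightarrow> p \<in> I \<and> l \<in> neighbors p \<and> l \<in> I \<and> {p, l} \<notin> W"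

text \<open>The point reflection of \<open>l\<close> in \<open>p\<close>: for a neighbor \<open>l\<close> of \<open>p\<close>, this is the other member
  of the horizontal or vertical pair to which \<open>l\<close> belongs.\<close>

definition opposite :: "node \<Rightarrow> node \<Rightarrow> node" where
  "opposite p l = (2 * fst p - fst l, 2 * snd p - snd l)"

text \<open>The value 2 comes from mirroring a node at a wall or at the boundary of the discovered
  domain (second-order Neumann condition).\<close>

definition weight :: "node set \<Rightarrow> node set set \<Rightarrow> node \<Rightarrow> node \<Rightarrow> real" where
  "weight I W p l =
     (if accessible I W p l
      then (if accessible I W p (opposite p l) then 1 else 2)
      else 0)"

definition unvisited :: "(node \<Rightarrow> nat) \<Rightarrow> node \<Rightarrow> bool" where
  "unvisited c p \<longleftrightarrow> c p = 0"

definition source :: "(node \<Rightarrow> nat) \<Rightarrow> real \<Rightarrow> node \<Rightarrow> real" where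
  "source c S p = max 0 (1 - real (c p)) * S"

text \<open>Elements of \<open>\<real>\<^sup>I\<close> are the extensional functions \<open>I \<rightarrow>\<^sub>E UNIV\<close>. In the sums below,
  neighbors outside \<open>I\<close> have weight 0 and do not contribute.\<close>

definition jacobi_step ::
    "node set \<Rightarrow> node set set \<Rightarrow> (node \<Rightarrow> real) \<Rightarrow> real \<Rightarrow> (node \<Rightarrow> real) \<Rightarrow> node \<Rightarrow> real" where
  "jacobi_step I W s \<alpha> u =
     (\<lambda>p\<in>I. ((\<Sum>l\<in>neighbors p. weight I W p l * u l) + s p) /
            ((\<Sum>l\<in>neighbors p. weight I W p l) + \<alpha>))"

definition solves_system ::
    "node set \<Rightarrow> node set set \<Rightarrow> (node \<Rightarrow> real) \<Rightarrow> real \<Rightarrow> (node \<Rightarrow> real) \<Rightarrow> bool" where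
  "solves_system I W s \<alpha> u \<longleftrightarrow>
     (\<forall>p\<in>I. ((\<Sum>l\<in>neighbors p. weight I W p l) + \<alpha>) * u p
              - (\<Sum>l\<in>neighbors p. weight I W p l * u l) = s p)"

definition local_max_at :: "node set \<Rightarrow> node set set \<Rightarrow> (node \<Rightarrow> real) \<Rightarrow> node \<Rightarrow> bool" where
  "local_max_at I W u p \<longleftrightarrow> p \<in> I \<and> (\<forall>l. accessible I W p l \<longrightarrow> u p \<ge> u l)"

text \<open>A finite, possibly empty, path of accessible neighbors leads from \<open>p\<close> to an unvisited
  node. Where this fails, the solution of the system vanishes on the whole connected component
  of \<open>p\<close>, so every node of the component is a local maximum although all of them are visited.\<close>

definition reaches_unvisited ::
    "node set \<Rightarrow> node set set \<Rightarrow> (node \<Rightarrow> nat) \<Rightarrow> node \<Rightarrow> bool" where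
  "reaches_unvisited I W c p \<longleftrightarrow> (\<exists>q. (accessible I W)\<^sup>*\<^sup>* p q \<and> unvisited c q)"

end

theory Submission
  imports Defs
begin

text \<open>The weights at a node sum to at most 8, so the Jacobi step contracts the maximum norm on
  \<open>\<real>\<^sup>I\<close> with factor \<open>8 / (8 + \<alpha>)\<close>, and its fixed points are the solutions of the system. Starting
  from 0 the iterates stay nonnegative, hence so does the solution. At a visited local maximum the
  equation forces the value 0. A zero of a nonnegative solution has zero source, and its zero value
  spreads to the accessible neighbors, hence along paths, so no unvisited node can be reached
  from it.\<close>

section \<open>Bounds on the interface weights\<close>

lemma finite_neighbors [simp]: "finite (neighbors p)"
  by (simp add: neighbors_def split: prod.split)

lemma weight_nonneg: "weight I W p l \<ge> 0"
  by (simp add: weight_def)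

lemma weight_pos_iff: "weight I W p l > 0 \<longleftrightarrow> accessible I W p l"
  by (simp add: weight_def)

lemma weight_eq_0: "\<not> accessible I W p l \<Longrightarrow> weight I W p l = 0"
  by (simp add: weight_def)

lemma accessible_imp_mem: "accessible I W p l \<Longrightarrow> l \<in> I"
  by (simp add: accessible_def)

lemma sum_weight_nonneg: "(\<Sum>l\<in>neighbors p. weight I W p l) \<ge> 0"
  by (simp add: sum_nonneg weight_nonneg)

text \<open>Four neighbors contribute at most 2 each. This is cruder than the true bound 4, but any
  bound independent of the node yields a contraction factor below 1.\<close>

lemma sum_weight_le: "(\<Sum>l\<in>neighbors p. weight I W p l) \<le> 8"
proof -
  have "card (neighbors p) \<le> 4"
    by (auto simp: neighbors_def card_insert_if split: prod.split)
  moreover have "(\<Sum>l\<in>neighbors p. weight I W p l) \<le> real (card (neighbors p)) * 2"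
    by (rule sum_bounded_above) (simp add: weight_def)
  ultimately show ?thesis
    by linarith
qed

section \<open>The Jacobi step: fixed points and contraction\<close>

lemma jacobi_step_mem: "jacobi_step I W s \<alpha> u \<in> I \<rightarrow>\<^sub>E UNIV"
  by (simp add: jacobi_step_def)

lemma jacobi_step_apply:
  "p \<in> I \<Longrightarrow> jacobi_step I W s \<alpha> u p =
    ((\<Sum>l\<in>neighbors p. weight I W p l * u l) + s p) / ((\<Sum>l\<in>neighbors p. weight I W p l) + \<alpha>)"
  by (simp add: jacobi_step_def)

lemma solves_system_iff_fixed_point:
  assumes "\<alpha> > 0" "u \<in> I \<rightarrow>\<^sub>E UNIV"
  shows "solves_system I W s \<alpha> u \<longleftrightarrow> jacobi_step I W s \<alpha> u = u"
proof -
  \<comment> \<open>Both functions are \<open>undefined\<close> off \<open>I\<close>, so their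
    equality is decided on \<open>I\<close>.\<close>
  have "jacobi_step I W s \<alpha> u = u \<longleftrightarrow> (\<forall>p\<in>I. jacobi_step I W s \<alpha> u p = u p)"
    using extensionalityI[of "jacobi_step I W s \<alpha> u" I u] assms(2) jacobi_step_mem[of I W s \<alpha> u]
    by (metis PiE_iff)
  moreover have "jacobi_step I W s \<alpha> u p = u p \<longleftrightarrow>
      ((\<Sum>l\<in>neighbors p. weight I W p l) + \<alpha>) * u p
        - (\<Sum>l\<in>neighbors p. weight I W p l * u l) = s p" if "p \<in> I" for p
  proof -
    have "(\<Sum>l\<in>neighbors p. weight I W p l) + \<alpha> \<noteq> 0"
      using sum_weight_nonneg[of I W p] assms(1) by linarith
    then show ?thesis
      using that by (auto simp: jacobi_step_apply divide_eq_eq algebra_simps)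
  qed
  ultimately show ?thesis
    by (simp add: solves_system_def)
qed

text \<open>The source cancels in the difference of the two steps. What remains is a weighted sum of
  the \<open>u l - v l\<close>, so with \<open>A\<close> the sum of the weights the factor is
  \<open>A / (A + \<alpha>)\<close>.\<close>

lemma jacobi_step_contraction:
  assumes "\<alpha> > 0" and le: "\<And>l. l \<in> I \<Longrightarrow> \<bar>u l - v l\<bar> \<le> M" and "p \<in> I"
  shows "\<bar>jacobi_step I W s \<alpha> u p - jacobi_step I W s \<alpha> v p\<bar> \<le> 8 / (8 + \<alpha>) * M"
proof -
  define A where "A = (\<Sum>l\<in>neighbors p. weight I W p l)"
  have A: "0 \<le> A" "A \<le> 8"
    by (simp_all add: A_def sum_weight_nonneg sum_weight_le)
  have M: "0 \<le> M"
    using le[OF \<open>p \<in> I\<close>] by linarith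
  have "jacobi_step I W s \<alpha> u p - jacobi_step I W s \<alpha> v p
      = (\<Sum>l\<in>neighbors p. weight I W p l * (u l - v l)) / (A + \<alpha>)"
    using \<open>p \<in> I\<close>
    by (simp add: jacobi_step_apply A_def right_diff_distrib sum_subtractf flip: diff_divide_distrib)
  moreover have "\<bar>\<Sum>l\<in>neighbors p. weight I W p l * (u l - v l)\<bar>
      \<le> (\<Sum>l\<in>neighbors p. weight I W p l * M)"
  proof (rule order_trans[OF sum_abs], rule sum_mono)
    \<comment> \<open>The bound \<open>M\<close> is available only on \<open>I\<close>; a neighbor
      outside \<open>I\<close> has weight 0.\<close>
    fix l
    show "\<bar>weight I W p l * (u l - v l)\<bar> \<le> weight I W p l * M"
      using le[of l] accessible_imp_mem[of I W p l] weight_eq_0[of I W p l] weight_nonneg[of I W p l]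
      by (cases "accessible I W p l") (auto simp: abs_mult intro: mult_left_mono)
  qed
  ultimately have "\<bar>jacobi_step I W s \<alpha> u p - jacobi_step I W s \<alpha> v p\<bar> \<le> A * M / (A + \<alpha>)"
    using A \<open>\<alpha> > 0\<close> by (simp add: A_def divide_right_mono flip: sum_distrib_right)
  also have "\<dots> = A / (A + \<alpha>) * M"
    by simp
  \<comment> \<open>The quotient equals \<open>1 - \<alpha> / (A + \<alpha>)\<close> and hence
    increases with \<open>A\<close>.\<close>
  also have "A / (A + \<alpha>) \<le> 8 / (8 + \<alpha>)"
    using A \<open>\<alpha> > 0\<close> by (simp add: frac_le_eq divide_le_0_iff algebra_simps)
  finally show ?thesis
    using M by (simp add: mult_right_mono)
qed

lemma jacobi_iterates_dist:
  assumes "\<alpha> > 0" and "\<And>l. l \<in> I \<Longrightarrow> \<bar>u l - v l\<bar> \<le> M" and "p \<in> I"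
  shows "\<bar>(jacobi_step I W s \<alpha> ^^ r) u p - (jacobi_step I W s \<alpha> ^^ r) v p\<bar> \<le> (8 / (8 + \<alpha>)) ^ r * M"
  using assms(3)
proof (induction r arbitrary: p)
  case (Suc r)
  show ?case
    using jacobi_step_contraction[OF \<open>\<alpha> > 0\<close> Suc.IH Suc.prems] by (simp add: mult.assoc)
qed (use assms(2) in simp)

section \<open>Convergence of the iterates to a fixed point\<close>

lemma tendsto_jacobi_iterates_diff:
  assumes "finite I" "\<alpha> > 0" "p \<in> I"
  shows "(\<lambda>r. (jacobi_step I W s \<alpha> ^^ r) u p - (jacobi_step I W s \<alpha> ^^ r) v p) \<longlonglongrightarrow> 0"
proof (rule Lim_null_comparison)
  \<comment> \<open>As \<open>I\<close> is finite, the sum of all deviations dominates each of them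
    and stands in for their maximum.\<close>
  define M where "M = (\<Sum>l\<in>I. \<bar>u l - v l\<bar>)"
  have M: "\<bar>u l - v l\<bar> \<le> M" if "l \<in> I" for l
    unfolding M_def using assms(1) that by (intro member_le_sum) auto
  show "\<forall>\<^sub>F r in sequentially.
      norm ((jacobi_step I W s \<alpha> ^^ r) u p - (jacobi_step I W s \<alpha> ^^ r) v p) \<le> (8 / (8 + \<alpha>)) ^ r * M"
    using jacobi_iterates_dist[OF \<open>\<alpha> > 0\<close> M \<open>p \<in> I\<close>] by simp
  show "(\<lambda>r. (8 / (8 + \<alpha>)) ^ r * M) \<longlonglongrightarrow> 0"
    using \<open>\<alpha> > 0\<close> by (intro tendsto_mult_left_zero LIMSEQ_power_zero) simp
qed

text \<open>The increments of the sequence are dominated by a geometric series, so the series of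
  increments converges, and its partial sums telescope.\<close>

lemma convergent_jacobi_iterates:
  assumes "finite I" "\<alpha> > 0" "p \<in> I"
  shows "convergent (\<lambda>r. (jacobi_step I W s \<alpha> ^^ r) u p)"
proof -
  let ?x = "\<lambda>r. (jacobi_step I W s \<alpha> ^^ r) u p"
  define M where "M = (\<Sum>l\<in>I. \<bar>jacobi_step I W s \<alpha> u l - u l\<bar>)"
  have M: "\<bar>jacobi_step I W s \<alpha> u l - u l\<bar> \<le> M" if "l \<in> I" for l
    unfolding M_def
    by (rule member_le_sum[where f = "\<lambda>l. \<bar>jacobi_step I W s \<alpha> u l - u l\<bar>"]) (use assms(1) that in auto)
  \<comment> \<open>Iterate \<open>Suc r\<close> from \<open>u\<close> is iterate \<open>r\<close>
    from \<open>jacobi_step I W s \<alpha> u\<close>, so the increment compares two iterations with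
    different starting values.\<close>
  have "norm (?x (Suc r) - ?x r) \<le> (8 / (8 + \<alpha>)) ^ r * M" for r
    using jacobi_iterates_dist[OF \<open>\<alpha> > 0\<close> M \<open>p \<in> I\<close>]
    by (simp add: funpow_swap1)
  moreover have "summable (\<lambda>r. (8 / (8 + \<alpha>)) ^ r * M)"
    using \<open>\<alpha> > 0\<close> by (intro summable_mult2 summable_geometric) simp
  ultimately have "summable (\<lambda>r. ?x (Suc r) - ?x r)"
    by (rule summable_comparison_test'[rotated])
  then have "convergent (\<lambda>r. ?x r - ?x 0)"
    by (simp only: summable_iff_convergent sum_lessThan_telescope[of ?x])
  then have "convergent (\<lambda>r. ?x r - ?x 0 + ?x 0)"
    by (intro convergent_add convergent_const)
  then show ?thesis
    by simp
qed

text \<open>The step depends continuously on finitely many values, so the limit can be taken on both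
  sides of the recursion.\<close>

lemma jacobi_limit_fixed_point:
  assumes "\<alpha> > 0" "ut \<in> I \<rightarrow>\<^sub>E UNIV"
    and lim: "\<And>p. p \<in> I \<Longrightarrow> (\<lambda>r. (jacobi_step I W s \<alpha> ^^ r) u p) \<longlonglongrightarrow> ut p"
  shows "jacobi_step I W s \<alpha> ut = ut"
proof (rule extensionalityI)
  fix p assume "p \<in> I"
  let ?x = "\<lambda>r. (jacobi_step I W s \<alpha> ^^ r) u"
  \<comment> \<open>Convergence is known only on \<open>I\<close>; for an inaccessible
    \<open>l\<close> the product is constantly 0.\<close>
  have "(\<lambda>r. weight I W p l * ?x r l) \<longlonglongrightarrow> weight I W p l * ut l" for l
    using lim[of l] accessible_imp_mem[of I W p l] weight_eq_0[of I W p l]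
    by (cases "accessible I W p l") (auto intro: tendsto_mult_left)
  moreover have "(\<Sum>l\<in>neighbors p. weight I W p l) + \<alpha> \<noteq> 0"
    using sum_weight_nonneg[of I W p] \<open>\<alpha> > 0\<close> by linarith
  ultimately have
    "(\<lambda>r. ((\<Sum>l\<in>neighbors p. weight I W p l * ?x r l) + s p) /
        ((\<Sum>l\<in>neighbors p. weight I W p l) + \<alpha>))
      \<longlonglongrightarrow> ((\<Sum>l\<in>neighbors p. weight I W p l * ut l) + s p) /
        ((\<Sum>l\<in>neighbors p. weight I W p l) + \<alpha>)"
    by (intro tendsto_divide tendsto_add tendsto_sum tendsto_const)
  then have "(\<lambda>r. jacobi_step I W s \<alpha> (?x r) p) \<longlonglongrightarrow> jacobi_step I W s \<alpha> ut p"
    using \<open>p \<in> I\<close> by (simp add: jacobi_step_apply)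
  moreover have "(\<lambda>r. jacobi_step I W s \<alpha> (?x r) p) \<longlonglongrightarrow> ut p"
    using LIMSEQ_Suc[OF lim[OF \<open>p \<in> I\<close>]] by simp
  ultimately show "jacobi_step I W s \<alpha> ut p = ut p"
    by (rule LIMSEQ_unique)
qed (use assms(2) jacobi_step_mem[of I W s \<alpha> ut] in \<open>auto simp: PiE_iff\<close>)

section \<open>Nonnegativity, zeros and local maxima of the solution\<close>

lemma jacobi_iterates_nonneg:
  assumes "\<alpha> > 0" and "\<And>p. p \<in> I \<Longrightarrow> s p \<ge> 0" and "\<And>p. p \<in> I \<Longrightarrow> u p \<ge> 0" and "p \<in> I"
  shows "(jacobi_step I W s \<alpha> ^^ r) u p \<ge> 0"
  using assms(4)
proof (induction r arbitrary: p)
  case (Suc r)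
  have "weight I W p l * (jacobi_step I W s \<alpha> ^^ r) u l \<ge> 0" for l
    using Suc.IH[of l] accessible_imp_mem[of I W p l] weight_eq_0[of I W p l] weight_nonneg[of I W p l]
    by (cases "accessible I W p l") auto
  then show ?case
    using Suc.prems assms(1,2) sum_weight_nonneg[of I W p]
    by (simp add: jacobi_step_apply sum_nonneg)
qed (use assms(3) in simp)

text \<open>A discrete strong minimum principle: where \<open>u p = 0\<close>, the equation equates
  minus a sum of nonnegative terms with a nonnegative source. Both sides therefore vanish, as does
  every term, and accessible neighbors have positive weight.\<close>

lemma solution_zero_spreads:
  assumes "solves_system I W s \<alpha> u" and "\<And>p. p \<in> I \<Longrightarrow> s p \<ge> 0"
    and nonneg: "\<And>p. p \<in> I \<Longrightarrow> u p \<ge> 0" and "p \<in> I" "u p = 0"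
  shows "s p = 0" and "accessible I W p l \<Longrightarrow> u l = 0"
proof -
  have nonneg': "weight I W p l * u l \<ge> 0" for l
    using nonneg[of l] accessible_imp_mem[of I W p l] weight_eq_0[of I W p l] weight_nonneg[of I W p l]
    by (cases "accessible I W p l") auto
  then have "(\<Sum>l\<in>neighbors p. weight I W p l * u l) \<ge> 0"
    by (intro sum_nonneg)
  moreover have "- (\<Sum>l\<in>neighbors p. weight I W p l * u l) = s p"
    using assms(1,4,5) by (auto simp: solves_system_def)
  ultimately have sum0: "(\<Sum>l\<in>neighbors p. weight I W p l * u l) = 0" and s0: "s p = 0"
    using assms(2)[OF \<open>p \<in> I\<close>] by linarith+
  show "s p = 0"
    by (fact s0)
  show "u l = 0" if "accessible I W p l"
    using sum0 nonneg' that weight_pos_iff[of I W p l]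
    by (auto simp: sum_nonneg_eq_0_iff accessible_def)
qed

text \<open>At a local maximum the weighted neighbor sum is at most the total weight times
  \<open>u p\<close>, so the equation leaves \<open>\<alpha> * u p \<le> s p = 0\<close>.\<close>

lemma solution_zero_at_local_max:
  assumes "solves_system I W s \<alpha> u" "\<alpha> > 0" "local_max_at I W u p" "s p = 0" "u p \<ge> 0"
  shows "u p = 0"
proof -
  have "weight I W p l * u l \<le> weight I W p l * u p" for l
  proof (cases "accessible I W p l")
    case True
    then have "u l \<le> u p"
      using assms(3) unfolding local_max_at_def by blast
    then show ?thesis
      by (simp add: mult_left_mono weight_nonneg)
  qed (simp add: weight_eq_0)
  then have "(\<Sum>l\<in>neighbors p. weight I W p l * u l) \<le> (\<Sum>l\<in>neighbors p. weight I W p l) * u p"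
    by (simp add: sum_distrib_right sum_mono)
  moreover have "((\<Sum>l\<in>neighbors p. weight I W p l) + \<alpha>) * u p
      - (\<Sum>l\<in>neighbors p. weight I W p l * u l) = s p"
    using assms(1,3) unfolding solves_system_def local_max_at_def by blast
  ultimately have "\<alpha> * u p \<le> 0"
    using assms(4) by (simp add: distrib_right)
  then show ?thesis
    using assms(2,5) by (simp add: mult_le_0_iff)
qed

lemma source_nonneg: "S \<ge> 0 \<Longrightarrow> source c S p \<ge> 0"
  by (simp add: source_def)

lemma source_eq_0_iff: "S \<noteq> 0 \<Longrightarrow> source c S p = 0 \<longleftrightarrow> \<not> unvisited c p"
  by (auto simp: source_def unvisited_def max_def)

theorem theorem3p1:
  fixes I :: "node set" and W :: "node set set" and c :: "node \<Rightarrow> nat" and S \<alpha> :: real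
  assumes "finite I" and "I \<noteq> {}"
    and "\<forall>p\<in>I. \<exists>l. accessible I W p l"
    and "S > 0" and "\<alpha> > 0"
  shows "\<exists>ut \<in> I \<rightarrow>\<^sub>E UNIV.
           (\<forall>v \<in> I \<rightarrow>\<^sub>E UNIV. solves_system I W (source c S) \<alpha> v \<longleftrightarrow> v = ut) \<and>
           (\<forall>u0 \<in> I \<rightarrow>\<^sub>E UNIV. \<forall>p\<in>I.
              (\<lambda>r. (jacobi_step I W (source c S) \<alpha> ^^ r) u0 p) \<longlonglongrightarrow> ut p) \<and>
           (\<forall>p\<in>I. reaches_unvisited I W c p \<longrightarrow> local_max_at I W ut p \<longrightarrow> unvisited c p)"
proof -
  let ?T = "jacobi_step I W (source c S) \<alpha>"
  \<comment> \<open>Starting from 0 makes all iterates nonnegative on \<open>I\<close>, which passes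
    to the limit. The zero function is not extensional, but its values off \<open>I\<close> meet
    only weight 0.\<close>
  define ut where "ut = (\<lambda>p\<in>I. lim (\<lambda>r. (?T ^^ r) (\<lambda>_. 0) p))"
  have ut: "ut \<in> I \<rightarrow>\<^sub>E UNIV"
    by (simp add: ut_def)
  have lim0: "(\<lambda>r. (?T ^^ r) (\<lambda>_. 0) p) \<longlonglongrightarrow> ut p" if "p \<in> I" for p
    using convergent_jacobi_iterates[OF \<open>finite I\<close> \<open>\<alpha> > 0\<close> that] that
    by (simp add: ut_def convergent_LIMSEQ_iff)
  have lim: "(\<lambda>r. (?T ^^ r) u p) \<longlonglongrightarrow> ut p" if "p \<in> I" for u p
    by (rule Lim_transform[OF lim0[OF that]])
      (rule tendsto_jacobi_iterates_diff[OF \<open>finite I\<close> \<open>\<alpha> > 0\<close> that])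
  have fixed: "?T ut = ut"
    by (rule jacobi_limit_fixed_point[OF \<open>\<alpha> > 0\<close> ut lim0])
  then have solves: "solves_system I W (source c S) \<alpha> ut"
    by (simp add: solves_system_iff_fixed_point \<open>\<alpha> > 0\<close> ut)
  have unique: "v = ut" if v: "v \<in> I \<rightarrow>\<^sub>E UNIV" "solves_system I W (source c S) \<alpha> v" for v
  proof (rule extensionalityI)
    fix p assume "p \<in> I"
    have "?T v = v"
      using v solves_system_iff_fixed_point[OF \<open>\<alpha> > 0\<close>] by blast
    \<comment> \<open>Iteration started at the solution \<open>v\<close> is constant, while its
      limit is \<open>ut\<close> as for every start.\<close>
    then have "(?T ^^ r) v = v" for r
      by (induction r) auto
    then show "v p = ut p"
      using lim[OF \<open>p \<in> I\<close>, of v] by (simp add: LIMSEQ_const_iff)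
  qed (use ut v in \<open>auto simp: PiE_iff\<close>)
  have source: "source c S p \<ge> 0" for p
    using \<open>S > 0\<close> by (simp add: source_nonneg)
  have nonneg: "ut p \<ge> 0" if "p \<in> I" for p
    using jacobi_iterates_nonneg[OF \<open>\<alpha> > 0\<close> source _ that]
    by (intro LIMSEQ_le_const[OF lim0[OF that]]) simp
  have max: "unvisited c p"
    if p: "p \<in> I" "reaches_unvisited I W c p" "local_max_at I W ut p" for p
  proof (rule ccontr)
    assume "\<not> unvisited c p"
    then have "source c S p = 0"
      using \<open>S > 0\<close> by (simp add: source_eq_0_iff)
    then have "ut p = 0"
      by (rule solution_zero_at_local_max[OF solves \<open>\<alpha> > 0\<close> p(3) _ nonneg[OF p(1)]])
    obtain q where q: "(accessible I W)\<^sup>*\<^sup>* p q" "unvisited c q"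
      using p(2) unfolding reaches_unvisited_def by blast
    \<comment> \<open>The zero is carried along the path; membership in \<open>I\<close> is carried
      with it because the equation holds only there.\<close>
    from q(1) have "q \<in> I \<and> ut q = 0"
    proof induction
      case base
      show ?case
        using \<open>p \<in> I\<close> \<open>ut p = 0\<close> by simp
    next
      case (step y z)
      have "ut z = 0"
        using step solution_zero_spreads(2)[OF solves source nonneg, of y z] by blast
      with step(2) show ?case
        by (simp add: accessible_imp_mem)
    qed
    then have "source c S q = 0"
      using solution_zero_spreads(1)[OF solves source nonneg, of q] by simp
    with q(2) \<open>S > 0\<close> show False
      by (simp add: source_eq_0_iff)
  qed
  show ?thesis
  proof (intro bexI[OF _ ut] conjI ballI impI)
    show "solves_system I W (source c S) \<alpha> v \<longleftrightarrow> v = ut" if "v \<in> I \<rightarrow>\<^sub>E UNIV" for v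
      using unique[OF that] solves by blast
  qed (rule lim max; assumption)+
qed

end
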